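(* Let $\mathscr{A}\subset\mathscr{X}$ be an acceptance set and $S=(S_0,S_T)$ and $R=(R_0,R_T)$ two traded assets with the same initial price $S_0=R_0$. Assume that $\rho_{\mathscr{A},S}$ and $\rho_{\mathscr{A},R}$ are lower semicontinuous. If $\rho_{\mathscr{A},S}(X)\le\rho_{\mathscr{A},R}(X)$ for every $X\in\mathscr{X}$, then $\rho_{\mathscr{A},S}=\rho_{\mathscr{A},R}$.
   Context: Let $(\Omega,\mathcal{F})$ be a measurable space and $\mathscr{X}$ the Banach space of bounded $\mathcal{F}$-measurable functions $X:\Omega\to\mathbb{R}$ with the supremum norm, ordered pointwise; $\mathscr{X}_+=\{X\in\mathscr{X}: X\ge 0\}$. Functions are not identified almost surely. An acceptance set is a nonempty proper subset $\mathscr{A}\subset\mathscr{X}$ such that $X\in\mathscr{A}$ and $Y\ge X$ imply $Y\in\mathscr{A}$. A traded asset is a pair $S=(S_0,S_T)$ with $S_0\in\mathbb{R}$, $S_0>0$, and $S_T\in\mathscr{X}_+$, $S_T\ne 0$. The risk measure is $\rho_{\mathscr{A},S}:\mathscr{X}\to\mathbb{R}\cup\{-\infty,\infty\}$, $\rho_{\mathscr{A},S}(X)=\inf\{m\in\mathbb{R}: X+\frac{m}{S_0}S_T\in\mathscr{A}\}$ (with $\inf\emptyset=\infty$). A map $\rho:\mathscr{X}\to\mathbb{R}\cup\{-\infty,\infty\}$ is lower semicontinuous if $\{X\in\mathscr{X}:\rho(X)\le\lambda\}$ is norm closed for every $\lambda\in\mathbb{R}$. *)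

theory Defs
  imports "HOL-Analysis.Analysis"
begin

(* A measurable space (Omega, F) is represented by a measure M through "space M" and "sets M"; the
   measure of M is never used, so nothing is identified almost surely.  Functions on Omega are
   represented by the functions that are extensional on "space M", so that HOL equality is equality
   of functions on Omega. *)

definition bdd_meas :: "'a measure \<Rightarrow> ('a \<Rightarrow> real) set" where
  "bdd_meas M = {X. X \<in> extensional (space M) \<and> X \<in> borel_measurable M \<and> bounded (X ` space M)}"

definition pos_cone :: "'a measure \<Rightarrow> ('a \<Rightarrow> real) set" where
  "pos_cone M = {X \<in> bdd_meas M. \<forall>\<omega>\<in>space M. 0 \<le> X \<omega>}"

(* funspace carries the supremum distance. *)
definition sup_metric :: "'a measure \<Rightarrow> ('a \<Rightarrow> real) metric" where
  "sup_metric M = submetric (funspace (space M) euclidean_metric) (bdd_meas M)"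

definition acceptance_set :: "'a measure \<Rightarrow> ('a \<Rightarrow> real) set \<Rightarrow> bool" where
  "acceptance_set M A \<longleftrightarrow>
     A \<noteq> {} \<and> A \<subset> bdd_meas M \<and>
     (\<forall>X\<in>A. \<forall>Y\<in>bdd_meas M. (\<forall>\<omega>\<in>space M. X \<omega> \<le> Y \<omega>) \<longrightarrow> Y \<in> A)"

definition traded_asset :: "'a measure \<Rightarrow> real \<times> ('a \<Rightarrow> real) \<Rightarrow> bool" where
  "traded_asset M S \<longleftrightarrow>
     0 < fst S \<and> snd S \<in> pos_cone M \<and> (\<exists>\<omega>\<in>space M. snd S \<omega> \<noteq> 0)"

(* The restriction to space M makes the sum X + (m / S_0) S_T extensional again.
   In ereal, Inf {} is \<infinity>. *)
definition risk_measure ::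
    "'a measure \<Rightarrow> ('a \<Rightarrow> real) set \<Rightarrow> real \<times> ('a \<Rightarrow> real) \<Rightarrow> ('a \<Rightarrow> real) \<Rightarrow> ereal" where
  "risk_measure M A S X =
     Inf {ereal m | m. (\<lambda>\<omega>\<in>space M. X \<omega> + m / fst S * snd S \<omega>) \<in> A}"

definition lower_semicont :: "'a measure \<Rightarrow> (('a \<Rightarrow> real) \<Rightarrow> ereal) \<Rightarrow> bool" where
  "lower_semicont M \<rho> \<longleftrightarrow>
     (\<forall>l::real. closedin (mtopology_of (sup_metric M)) {X \<in> bdd_meas M. \<rho> X \<le> ereal l})"

lemma mbounded_euclidean:
  fixes B :: "real set"
  shows "Metric_space.mbounded UNIV dist B \<longleftrightarrow> bounded B"
  using Met_TC.mbounded_def[of B] by (fastforce simp: bounded_def subset_iff)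

lemma bdd_meas_subset_funspace:
  "bdd_meas M \<subseteq> mspace (funspace (space M) euclidean_metric)"
  by (auto simp: bdd_meas_def Metric_space.fspace_def[OF Met_TC.Metric_space_axioms] mbounded_euclidean)

lemma mspace_sup_metric [simp]: "mspace (sup_metric M) = bdd_meas M"
  unfolding sup_metric_def mspace_submetric using bdd_meas_subset_funspace by blast

lemma mdist_sup_metric:
  assumes "X \<in> bdd_meas M" "Y \<in> bdd_meas M" "space M \<noteq> {}"
  shows "mdist (sup_metric M) X Y = (SUP \<omega>\<in>space M. \<bar>X \<omega> - Y \<omega>\<bar>)"
  using bdd_meas_subset_funspace[of M] assms
  by (auto simp: sup_metric_def Metric_space.fdist_def[OF Met_TC.Metric_space_axioms] dist_real_def subset_iff)

end

theory Submission
  imports Defs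
begin

text \<open>
  Write \<open>C(S)\<close> for the set of positions \<open>X\<close> with risk at most \<open>0\<close> with respect to \<open>S\<close>. Such an
  \<open>X\<close> is the uniform limit of the acceptable positions \<open>X + \<epsilon> S\<^sub>T\<close>, so \<open>C(S)\<close> is contained in
  the closed set \<open>C(R)\<close>, while \<open>C(R) \<subseteq> C(S)\<close> holds by the domination; let \<open>C\<close> be the common set.
  By translation along the assets, domination means that \<open>Y \<in> C\<close> implies
  \<open>Y + t (R\<^sub>T - S\<^sub>T) \<in> C\<close> for every real \<open>t\<close>, of either sign (prices normalised to 1).
  Hence \<open>X + m S\<^sub>T \<in> C\<close> implies \<open>X + m R\<^sub>T \<in> C\<close>.
\<close>

text \<open>Restricting to \<open>space M\<close> keeps the result extensional, so the composition
  laws below are equations between functions. The infimum in \<open>risk_measure\<close> runs over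
  the \<open>m\<close> with \<open>trade M S m X \<in> A\<close>.\<close>

definition trade :: "'a measure \<Rightarrow> real \<times> ('a \<Rightarrow> real) \<Rightarrow> real \<Rightarrow> ('a \<Rightarrow> real) \<Rightarrow> 'a \<Rightarrow> real" where
  "trade M S m X = (\<lambda>\<omega>\<in>space M. X \<omega> + m / fst S * snd S \<omega>)"

lemma trade_apply [simp]: "\<omega> \<in> space M \<Longrightarrow> trade M S m X \<omega> = X \<omega> + m / fst S * snd S \<omega>"
  by (simp add: trade_def)

lemma trade_in_bdd_meas:
  assumes "X \<in> bdd_meas M" "snd S \<in> bdd_meas M"
  shows "trade M S m X \<in> bdd_meas M"
proof -
  have "trade M S m X \<in> borel_measurable M"
    using assms by (subst measurable_cong[OF trade_apply]) (auto simp: bdd_meas_def)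
  moreover have "bounded (trade M S m X ` space M)"
  proof -
    have "bounded ((\<lambda>\<omega>. X \<omega> + (m / fst S) * snd S \<omega>) ` space M)"
      using assms bounded_scaling[of "snd S ` space M" "m / fst S"]
      by (intro bounded_plus_comp) (auto simp: bdd_meas_def image_image)
    then show ?thesis by (simp cong: image_cong)
  qed
  ultimately show ?thesis by (auto simp: bdd_meas_def trade_def)
qed

lemma trade_trade: "trade M S a (trade M S b X) = trade M S (a + b) X"
  by (rule ext) (simp add: trade_def add_divide_distrib algebra_simps)

lemma trade_commute: "trade M S a (trade M R b X) = trade M R b (trade M S a X)"
  by (rule ext) (simp add: trade_def)

lemma trade_zero: "X \<in> bdd_meas M \<Longrightarrow> trade M S 0 X = X"
  by (simp add: trade_def bdd_meas_def extensional_restrict)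

text \<open>The infimum need not be attained, hence the strict \<open>l < m\<close>: some
  \<open>k < m\<close> makes the position acceptable, and since the payoff is nonnegative and the
  price positive, raising \<open>k\<close> to \<open>m\<close> keeps it so.\<close>

lemma trade_in_acceptance_set_if_risk_le:
  assumes A: "acceptance_set M A" and S: "traded_asset M S" and X: "X \<in> bdd_meas M"
    and le: "risk_measure M A S X \<le> ereal l" and "l < m"
  shows "trade M S m X \<in> A"
proof -
  have "Inf {ereal k |k. trade M S k X \<in> A} < ereal m"
    using le_less_trans[OF le, of "ereal m"] \<open>l < m\<close>
    unfolding risk_measure_def trade_def by simp
  then obtain k where k: "trade M S k X \<in> A" "k < m"
    by (auto simp: Inf_less_iff)
  have "trade M S k X \<omega> \<le> trade M S m X \<omega>" if "\<omega> \<in> space M" for \<omega>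
    using S k that by (auto simp: traded_asset_def pos_cone_def intro!: mult_right_mono divide_right_mono)
  moreover have "trade M S m X \<in> bdd_meas M"
    using S X by (intro trade_in_bdd_meas) (auto simp: traded_asset_def pos_cone_def)
  ultimately show ?thesis
    using A k(1) unfolding acceptance_set_def by blast
qed

lemma risk_le_if_trade_in_acceptance_set:
  "trade M S m X \<in> A \<Longrightarrow> risk_measure M A S X \<le> ereal m"
  unfolding risk_measure_def trade_def by (rule Inf_lower) blast

text \<open>This is translation along the asset, stated as one inequality with real bounds, so that
  infinite risks need no arithmetic. Using \<open>- c\<close> for \<open>c\<close> undoes the shift.
  The slack \<open>e\<close> in the proof again allows for an infimum that is not attained.\<close>

lemma risk_trade_le:
  assumes A: "acceptance_set M A" and S: "traded_asset M S" and X: "X \<in> bdd_meas M"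
    and le: "risk_measure M A S X \<le> ereal l"
  shows "risk_measure M A S (trade M S c X) \<le> ereal (l - c)"
proof (rule ereal_le_epsilon2)
  fix e :: real
  assume "0 < e"
  then have "trade M S (l + e) X \<in> A"
    using trade_in_acceptance_set_if_risk_le[OF A S X le] by simp
  then have "trade M S (l - c + e) (trade M S c X) \<in> A"
    by (simp add: trade_trade)
  then show "risk_measure M A S (trade M S c X) \<le> ereal (l - c) + ereal e"
    by (simp add: risk_le_if_trade_in_acceptance_set)
qed

lemma trade_tendsto:
  assumes S: "traded_asset M S" and X: "X \<in> bdd_meas M" and t: "t \<longlonglongrightarrow> 0"
  shows "limitin (mtopology_of (sup_metric M)) (\<lambda>n. trade M S (t n) X) X sequentially"
proof -
  \<comment> \<open>The supremum formula for the distance needs a point of \<open>space M\<close>; a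
    payoff that is not identically zero provides one.\<close>
  have ST: "snd S \<in> bdd_meas M" and ne: "space M \<noteq> {}"
    using S by (auto simp: traded_asset_def pos_cone_def)
  obtain B where B: "\<And>\<omega>. \<omega> \<in> space M \<Longrightarrow> \<bar>snd S \<omega>\<bar> \<le> B" and "0 < B"
    using ST bounded_pos[of "snd S ` space M"] by (auto simp: bdd_meas_def)
  have mdist_le: "mdist (sup_metric M) (trade M S (t n) X) X \<le> \<bar>t n / fst S\<bar> * B" for n
    unfolding mdist_sup_metric[OF trade_in_bdd_meas[OF X ST] X ne]
  proof (intro cSUP_least ne)
    fix \<omega>
    assume "\<omega> \<in> space M"
    then have "\<bar>trade M S (t n) X \<omega> - X \<omega>\<bar> = \<bar>t n / fst S\<bar> * \<bar>snd S \<omega>\<bar>"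
      by (simp add: abs_mult)
    also have "\<dots> \<le> \<bar>t n / fst S\<bar> * B"
      by (intro mult_left_mono B \<open>\<omega> \<in> space M\<close>) simp
    finally show "\<bar>trade M S (t n) X \<omega> - X \<omega>\<bar> \<le> \<bar>t n / fst S\<bar> * B" .
  qed
  have lim: "(\<lambda>n. \<bar>t n / fst S\<bar> * B) \<longlonglongrightarrow> 0"
    using S by (auto intro!: tendsto_eq_intros t simp: traded_asset_def)
  show ?thesis
    unfolding mtopology_of_def
      Metric_space.limit_metric_sequentially[OF Metric_space_mspace_mdist]
  proof (intro conjI allI impI)
    fix e :: real
    assume "0 < e"
    from order_tendstoD(2)[OF lim this] obtain N where "\<And>n. n \<ge> N \<Longrightarrow> \<bar>t n / fst S\<bar> * B < e"
      by (auto simp: eventually_sequentially)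
    then show "\<exists>N. \<forall>n\<ge>N. trade M S (t n) X \<in> mspace (sup_metric M) \<and>
                 mdist (sup_metric M) (trade M S (t n) X) X < e"
      using mdist_le trade_in_bdd_meas[OF X ST] by (auto intro: le_less_trans)
  qed (use X in simp)
qed

lemma risk_nonpos_transfer:
  assumes A: "acceptance_set M A" and S: "traded_asset M S" and X: "X \<in> bdd_meas M"
    and R: "lower_semicont M (risk_measure M A R)"
    and le: "risk_measure M A S X \<le> 0"
  shows "risk_measure M A R X \<le> 0"
proof -
  define C where "C = {Y \<in> bdd_meas M. risk_measure M A R Y \<le> ereal 0}"
  \<comment> \<open>The amounts are strictly positive, as risk at most 0 does not make
    \<open>X\<close> itself acceptable.\<close>
  define Y where "Y n = trade M S (inverse (real (Suc n))) X" for n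
  have "closedin (mtopology_of (sup_metric M)) C"
    using R unfolding lower_semicont_def C_def by blast
  moreover have "Y n \<in> C" for n
  proof -
    have "Y n \<in> A"
      unfolding Y_def using le
      by (intro trade_in_acceptance_set_if_risk_le[OF A S X, of 0]) (auto simp: zero_ereal_def)
    moreover have "Y n \<in> bdd_meas M"
      using \<open>Y n \<in> A\<close> A by (auto simp: acceptance_set_def)
    \<comment> \<open>An acceptable position has risk at most 0 with respect to any asset: take the
      amount 0.\<close>
    ultimately show ?thesis
      using risk_le_if_trade_in_acceptance_set[of M R 0 "Y n" A] by (simp add: C_def trade_zero)
  qed
  moreover have "limitin (mtopology_of (sup_metric M)) Y X sequentially"
    unfolding Y_def by (rule trade_tendsto[OF S X LIMSEQ_inverse_real_of_nat])
  ultimately have "X \<in> C"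
    by (intro limitin_closedin[where f = Y and F = sequentially]) auto
  then show ?thesis by (simp add: C_def zero_ereal_def)
qed

theorem theorem5p4:
  fixes M :: "'a measure"
    and A :: "('a \<Rightarrow> real) set"
    and S R :: "real \<times> ('a \<Rightarrow> real)"
  assumes "acceptance_set M A"
    and "traded_asset M S"
    and "traded_asset M R"
    and "fst S = fst R"
    and "lower_semicont M (risk_measure M A S)"
    and "lower_semicont M (risk_measure M A R)"
    and "\<forall>X\<in>bdd_meas M. risk_measure M A S X \<le> risk_measure M A R X"
  shows "\<forall>X\<in>bdd_meas M. risk_measure M A S X = risk_measure M A R X"
proof
  fix X
  assume X: "X \<in> bdd_meas M"
  note A = assms(1) and S = assms(2) and R = assms(3)
  have mem: "trade M S m Y \<in> bdd_meas M" "trade M R m Y \<in> bdd_meas M" if "Y \<in> bdd_meas M" for m Y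
    using S R that by (auto simp: traded_asset_def pos_cone_def intro!: trade_in_bdd_meas)
  have transfer: "risk_measure M A R Y \<le> 0" if "Y \<in> bdd_meas M" "risk_measure M A S Y \<le> 0" for Y
    by (rule risk_nonpos_transfer[OF A S that(1) assms(6) that(2)])
  \<comment> \<open>Comparing real upper bounds also settles infinite values: risk \<infinity> has
    no such \<open>l\<close>, and risk -\<infinity> admits every \<open>l\<close>.\<close>
  have "risk_measure M A R X \<le> ereal l" if l: "risk_measure M A S X \<le> ereal l" for l
  proof -
    let ?XS = "trade M S l X" and ?XR = "trade M R l X"
    have "risk_measure M A S ?XS \<le> 0"
      using risk_trade_le[OF A S X l, of l] by (simp add: zero_ereal_def)
    then have "risk_measure M A R ?XS \<le> ereal 0"
      using transfer mem X by (simp add: zero_ereal_def)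
    \<comment> \<open>Buying along \<open>R\<close>, passing to the \<open>S\<close>-risk by
      domination and selling along \<open>S\<close> performs the exchange with \<open>t = l\<close>.
      It cancels the \<open>S\<close>-part of \<open>?XS\<close> and leaves
      \<open>?XR\<close>.\<close>
    then have "risk_measure M A R (trade M R l ?XS) \<le> ereal (- l)"
      using risk_trade_le[OF A R, of ?XS 0 l] mem X by simp
    then have "risk_measure M A S (trade M R l ?XS) \<le> ereal (- l)"
      using assms(7) mem X by (blast intro: order.trans)
    then have "risk_measure M A S (trade M S (- l) (trade M R l ?XS)) \<le> ereal 0"
      using risk_trade_le[OF A S, of "trade M R l ?XS" "- l" "- l"] mem X by simp
    also have "trade M S (- l) (trade M R l ?XS) = ?XR"
      using mem X by (simp add: trade_commute[of M R l S] trade_trade trade_zero)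
    finally have "risk_measure M A R ?XR \<le> ereal 0"
      using transfer mem X by (simp add: zero_ereal_def)
    \<comment> \<open>Selling the \<open>R\<close>-part of \<open>?XR\<close> recovers
      \<open>X\<close> and raises the bound from 0 to \<open>l\<close>.\<close>
    then have "risk_measure M A R (trade M R (- l) ?XR) \<le> ereal l"
      using risk_trade_le[OF A R, of ?XR 0 "- l"] mem X by simp
    then show ?thesis
      using X by (simp add: trade_trade trade_zero)
  qed
  then have "risk_measure M A R X \<le> risk_measure M A S X"
    by (rule ereal_le_real)
  then show "risk_measure M A S X = risk_measure M A R X"
    using assms(7) X by (simp add: order.antisym)
qed

end
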